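(* Let $k$ and $s$ be positive integers and let $x_1,\ldots,x_n$ be independent variables ($n\ge1$). Then $$H_k^{(s)}(x_1,\ldots,x_n)=(-1)^k\sum_{\substack{\lambda\vdash k\\ \ell(\lambda)\le s}}m_\lambda(\omega_{1,s+1},\omega_{2,s+1},\ldots,\omega_{s,s+1})\,h_\lambda(x_1,\ldots,x_n)$$ and $$E_k^{(s)}(x_1,\ldots,x_n)=(-1)^k\sum_{\substack{\lambda\vdash k\\ \ell(\lambda)\le s}}m_\lambda(\omega_{1,s+1},\omega_{2,s+1},\ldots,\omega_{s,s+1})\,e_\lambda(x_1,\ldots,x_n),$$ where $\omega_{j,s+1}=e^{2j\pi i/(s+1)}$ for $j=1,\ldots,s$.
   Context: For a positive integer $s$, $H_k^{(s)}$ and $E_k^{(s)}$ ($k\ge0$) are defined by the formal power series identities $$\sum_{k\ge0}H_k^{(s)}(x_1,\ldots,x_n)t^k=\prod_{i=1}^n\big(1-x_it+\cdots+(-x_it)^s\big)^{-1},\qquad \sum_{k\ge0}E_k^{(s)}(x_1,\ldots,x_n)t^k=\prod_{i=1}^n\big(1+x_it+\cdots+(x_it)^s\big).$$ $h_k$, $e_k$ are the complete homogeneous and elementary symmetric functions, $m_\lambda$ the monomial symmetric function, $\ell(\lambda)$ the number of parts of the partition $\lambda$, and for $\lambda=[\lambda_1,\ldots,\lambda_\ell]$, $h_\lambda=\prod_{i=1}^{\ell}h_{\lambda_i}$ and $e_\lambda=\prod_{i=1}^{\ell}e_{\lambda_i}$. *)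

theory Defs
  imports
    Complex_Main
    "HOL-Library.Multiset"
    "HOL-Library.FuncSet"
    "HOL-Library.Poly_Mapping"
    "HOL-Computational_Algebra.Formal_Power_Series"
begin

text \<open>
  Polynomials with complex coefficients in variables indexed by \<^typ>\<open>nat\<close> are finitely supported
  maps from exponent vectors (themselves finitely supported) to coefficients; multiplication is
  convolution.
\<close>

type_synonym cpoly = "(nat \<Rightarrow>\<^sub>0 nat) \<Rightarrow>\<^sub>0 complex"

definition Var :: "nat \<Rightarrow> cpoly" where
  "Var i = Poly_Mapping.single (Poly_Mapping.single i 1) 1"

definition Const :: "complex \<Rightarrow> cpoly" where
  "Const c = Poly_Mapping.single 0 c"

text \<open>
  In the following, the arguments \<open>x\<^sub>1, \<dots>, x\<^sub>n\<close> are given by \<open>x 1, \<dots>, x n\<close> for a function \<open>x\<close> on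
  \<^typ>\<open>nat\<close>; its other values are irrelevant.  They may lie in an arbitrary commutative ring, which
  need not have an inverse operation.  Hence the inverse power series in the definition of \<open>gen_H\<close>
  is \<open>fps_left_inverse\<close>, whose second argument is the inverse of the constant coefficient (here 1).
\<close>

definition gen_H :: "nat \<Rightarrow> nat \<Rightarrow> (nat \<Rightarrow> 'a::comm_ring_1) \<Rightarrow> 'a fps" where
  "gen_H s n x =
     (\<Prod>i=1..n. fps_left_inverse (\<Sum>j=0..s. (- (fps_const (x i) * fps_X)) ^ j) 1)"

definition gen_E :: "nat \<Rightarrow> nat \<Rightarrow> (nat \<Rightarrow> 'a::comm_ring_1) \<Rightarrow> 'a fps" where
  "gen_E s n x = (\<Prod>i=1..n. \<Sum>j=0..s. (fps_const (x i) * fps_X) ^ j)"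

definition H :: "nat \<Rightarrow> nat \<Rightarrow> nat \<Rightarrow> (nat \<Rightarrow> 'a::comm_ring_1) \<Rightarrow> 'a" where
  "H s k n x = fps_nth (gen_H s n x) k"

definition E :: "nat \<Rightarrow> nat \<Rightarrow> nat \<Rightarrow> (nat \<Rightarrow> 'a::comm_ring_1) \<Rightarrow> 'a" where
  "E s k n x = fps_nth (gen_E s n x) k"

lemma gen_H_mult_eq_1:
  fixes x :: "nat \<Rightarrow> 'a::comm_ring_1"
  shows "gen_H s n x * (\<Prod>i=1..n. \<Sum>j=0..s. (- (fps_const (x i) * fps_X)) ^ j) = 1"
proof -
  have "fps_nth (\<Sum>j=0..s. (- (fps_const (x i) * fps_X)) ^ j) 0 = 1" for i
    by (simp add: fps_sum_nth fps_nth_power_0 power_0_left)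
  then have "fps_left_inverse (\<Sum>j=0..s. (- (fps_const (x i) * fps_X)) ^ j) 1 *
      (\<Sum>j=0..s. (- (fps_const (x i) * fps_X)) ^ j) = 1" for i
    by (intro fps_left_inverse) simp
  then show ?thesis
    by (simp add: gen_H_def flip: prod.distrib)
qed

definition complete_sym :: "nat \<Rightarrow> nat \<Rightarrow> (nat \<Rightarrow> 'a::comm_ring_1) \<Rightarrow> 'a" where
  "complete_sym k n x = (\<Sum>M\<in>multisets_of_size {1..n} k. \<Prod>i\<in>#M. x i)"

definition elementary_sym :: "nat \<Rightarrow> nat \<Rightarrow> (nat \<Rightarrow> 'a::comm_ring_1) \<Rightarrow> 'a" where
  "elementary_sym k n x = (\<Sum>S\<in>{S. S \<subseteq> {1..n} \<and> card S = k}. \<Prod>i\<in>S. x i)"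

text \<open>
  A partition is the multiset of its (positive) parts, so that \<^const>\<open>size\<close> is the number of parts
  and \<^const>\<open>sum_mset\<close> is the number being partitioned.
\<close>

definition partitions_at_most :: "nat \<Rightarrow> nat \<Rightarrow> nat multiset set" where
  "partitions_at_most k s = {\<mu>. 0 \<notin># \<mu> \<and> sum_mset \<mu> = k \<and> size \<mu> \<le> s}"

definition complete_sym_part :: "nat multiset \<Rightarrow> nat \<Rightarrow> (nat \<Rightarrow> 'a::comm_ring_1) \<Rightarrow> 'a" where
  "complete_sym_part \<mu> n x = (\<Prod>p\<in>#\<mu>. complete_sym p n x)"

definition elementary_sym_part :: "nat multiset \<Rightarrow> nat \<Rightarrow> (nat \<Rightarrow> 'a::comm_ring_1) \<Rightarrow> 'a" where
  "elementary_sym_part \<mu> n x = (\<Prod>p\<in>#\<mu>. elementary_sym p n x)"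

text \<open>
  \<open>monomial_exponents \<mu> n\<close> consists of the distinct rearrangements \<open>a\<close> of \<open>\<mu>\<close> padded with zeros to
  length \<open>n\<close>: the multiset of nonzero entries of \<open>a\<close> is \<open>\<mu>\<close>.  It is empty if \<open>\<mu>\<close> has more than \<open>n\<close>
  parts.
\<close>

definition monomial_exponents :: "nat multiset \<Rightarrow> nat \<Rightarrow> (nat \<Rightarrow> nat) set" where
  "monomial_exponents \<mu> n =
     {a \<in> {1..n} \<rightarrow>\<^sub>E UNIV. {#p \<in># image_mset a (mset_set {1..n}). p \<noteq> 0#} = \<mu>}"

definition monomial_sym :: "nat multiset \<Rightarrow> nat \<Rightarrow> (nat \<Rightarrow> 'a::comm_ring_1) \<Rightarrow> 'a" where
  "monomial_sym \<mu> n x = (\<Sum>a\<in>monomial_exponents \<mu> n. \<Prod>i=1..n. x i ^ a i)"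

text \<open>Finiteness of the index sets (a sum over an infinite set would be 0).\<close>

lemma finite_partitions_at_most: "finite (partitions_at_most k s)"
proof (rule finite_subset)
  have "p \<le> sum_mset \<mu>" if "p \<in># \<mu>" for p :: nat and \<mu>
    using sum_mset.remove[OF that] by simp
  then show "partitions_at_most k s \<subseteq> (\<Union>m\<in>{0..s}. multisets_of_size {0..k} m)"
    by (auto simp: partitions_at_most_def multisets_of_size_def)
qed (auto intro: finite_multisets_of_size)

lemma finite_monomial_exponents: "finite (monomial_exponents \<mu> n)"
proof (rule finite_subset)
  show "monomial_exponents \<mu> n \<subseteq> {1..n} \<rightarrow>\<^sub>E insert 0 (set_mset \<mu>)"
    by (auto simp: monomial_exponents_def PiE_def)
qed (auto intro: finite_PiE)

definition omega :: "nat \<Rightarrow> nat \<Rightarrow> complex" where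
  "omega j m = exp (2 * of_nat j * of_real pi * \<i> / of_nat m)"

end

theory Submission
  imports Defs "HOL-Computational_Algebra.Polynomial_FPS"
begin

text \<open>
  Since \<open>1 + z + \<dots> + z\<^sup>s = (1 - \<omega>\<^sub>1 z) \<dots> (1 - \<omega>\<^sub>s z)\<close>, exchanging the two products turns the
  generating function of the \<open>E\<^sub>k\<close> into the product over \<open>j\<close> of \<open>\<Sum>\<^sub>p e\<^sub>p(x) (-\<omega>\<^sub>j t)\<^sup>p\<close>, and
  that of the \<open>H\<^sub>k\<close> into the product over \<open>j\<close> of \<open>\<Sum>\<^sub>p h\<^sub>p(x) (-\<omega>\<^sub>j t)\<^sup>p\<close>.  Collecting the
  exponent vectors with the same multiset of nonzero entries gives the sums over partitions.
\<close>

section \<open>Elementary symmetric functions and their generating series\<close>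

lemma prod_one_plus_fps_X:
  fixes x :: "nat \<Rightarrow> 'a::comm_ring_1"
  shows "(\<Prod>i=1..n. 1 + fps_const (x i) * fps_X) = Abs_fps (\<lambda>k. elementary_sym k n x)"
proof (rule fps_ext)
  fix k
  have eq: "(\<Prod>i\<in>S. fps_const (x i) * fps_X) = fps_const (\<Prod>i\<in>S. x i) * fps_X ^ card S" for S
    by (induction S rule: infinite_finite_induct) (auto simp: mult_ac simp flip: fps_const_mult)
  have "(\<Prod>i=1..n. 1 + fps_const (x i) * fps_X)
      = (\<Sum>S\<in>Pow {1..n}. fps_const (\<Prod>i\<in>S. x i) * fps_X ^ card S)"
    using prod_add[of "{1..n}" "\<lambda>i. fps_const (x i) * fps_X" "\<lambda>_. 1"]
    by (simp add: eq add.commute)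
  then have "fps_nth (\<Prod>i=1..n. 1 + fps_const (x i) * fps_X) k
      = (\<Sum>S\<in>Pow {1..n}. if card S = k then \<Prod>i\<in>S. x i else 0)"
    by (auto simp: fps_sum_nth fps_X_power_nth intro!: sum.cong)
  also have "\<dots> = elementary_sym k n x"
    by (auto simp: elementary_sym_def simp flip: sum.inter_filter intro!: sum.cong)
  finally show "fps_nth (\<Prod>i=1..n. 1 + fps_const (x i) * fps_X) k
      = fps_nth (Abs_fps (\<lambda>k. elementary_sym k n x)) k"
    by simp
qed

lemma elementary_sym_scale:
  fixes x :: "nat \<Rightarrow> 'a::comm_ring_1"
  shows "elementary_sym k n (\<lambda>i. c * x i) = c ^ k * elementary_sym k n x"
  by (auto simp: elementary_sym_def prod.distrib sum_distrib_left intro!: sum.cong)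

lemma elementary_sym_eq_0:
  assumes "k > n"
  shows "elementary_sym k n (x :: nat \<Rightarrow> 'a::comm_ring_1) = 0"
proof -
  have "card S \<noteq> k" if "S \<subseteq> {1..n}" for S
    using card_mono[OF _ that] assms by auto
  then have "{S. S \<subseteq> {1..n} \<and> card S = k} = {}"
    by auto
  then show ?thesis
    by (simp only: elementary_sym_def sum.empty)
qed

lemma elementary_sym_0: "elementary_sym 0 n (x :: nat \<Rightarrow> 'a::comm_ring_1) = 1"
proof -
  have "{S. S \<subseteq> {1..n} \<and> card S = 0} = {{}}"
    by (auto simp: card_eq_0_iff dest: finite_subset)
  then show ?thesis
    by (simp only: elementary_sym_def) simp
qed

text \<open>Used in two roles: with the numbers \<open>- w j\<close> as arguments and a single
  variable as \<open>c\<close>, and with the variables as arguments and a single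
  \<open>- w j\<close> as \<open>c\<close>. These are the two ways to read the double product over i
  and j.\<close>

lemma prod_one_plus_fps_X_scaled:
  fixes x :: "nat \<Rightarrow> 'a::comm_ring_1"
  shows "(\<Prod>i=1..n. 1 + fps_const (c * x i) * fps_X)
       = Abs_fps (\<lambda>k. elementary_sym k n x * c ^ k)"
  using prod_one_plus_fps_X[of "\<lambda>i. c * x i" n] by (simp add: elementary_sym_scale mult.commute)

section \<open>Complete homogeneous symmetric functions and their generating series\<close>

lemma prod_mset_eq_prod_power_count:
  fixes x :: "'b \<Rightarrow> 'a::comm_monoid_mult"
  assumes "finite A" "set_mset M \<subseteq> A"
  shows "(\<Prod>i\<in>#M. x i) = (\<Prod>i\<in>A. x i ^ count M i)"
proof -
  have "(\<Prod>i\<in>#M. x i) = (\<Prod>i\<in>set_mset M. x i ^ count M i)"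
    by (simp add: image_prod_mset_multiplicity)
  also have "\<dots> = (\<Prod>i\<in>A. x i ^ count M i)"
    using assms by (intro prod.mono_neutral_left) (auto simp: not_in_iff)
  finally show ?thesis .
qed

lemma geometric_fps:
  fixes a :: "'a::comm_ring_1"
  shows "Abs_fps (\<lambda>k. a ^ k) * (1 + fps_const (- a) * fps_X) = 1"
proof (rule fps_ext)
  fix k
  show "fps_nth (Abs_fps (\<lambda>k. a ^ k) * (1 + fps_const (- a) * fps_X)) k = fps_nth 1 k"
    by (cases k) (simp_all add: distrib_left mult.left_commute[of _ "fps_const _"])
qed

text \<open>The series is the product of the geometric series in \<open>c * x i\<close>: a term of
  degree k picks one exponent per factor, which is a multiset of size k over {1..n}. Each geometric
  series is inverse to one of the linear factors.\<close>

lemma complete_sym_fps: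
  fixes x :: "nat \<Rightarrow> 'a::comm_ring_1"
  shows "Abs_fps (\<lambda>k. complete_sym k n x * c ^ k)
       * (\<Prod>i=1..n. 1 + fps_const (- (c * x i)) * fps_X) = 1"
proof -
  have "Abs_fps (\<lambda>k. complete_sym k n x * c ^ k) = (\<Prod>i=1..n. Abs_fps (\<lambda>k. (c * x i) ^ k))"
  proof (rule fps_ext)
    fix k
    have "(\<Prod>i=1..n. (c * x i) ^ count M i) = (\<Prod>i\<in>#M. x i) * c ^ k"
      if "M \<in> multisets_of_size {1..n} k" for M
    proof -
      have "(\<Prod>i=1..n. (c * x i) ^ count M i) = (\<Prod>i\<in>#M. c * x i)"
        using that by (subst prod_mset_eq_prod_power_count[of "{1..n}"])
          (auto simp: multisets_of_size_def)
      then show ?thesis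
        using that by (simp add: prod_mset.distrib multisets_of_size_def mult.commute)
    qed
    then show "fps_nth (Abs_fps (\<lambda>k. complete_sym k n x * c ^ k)) k
        = fps_nth (\<Prod>i=1..n. Abs_fps (\<lambda>k. (c * x i) ^ k)) k"
      by (simp add: fps_prod_nth' complete_sym_def sum_distrib_right)
  qed
  then show ?thesis
    by (simp only: geometric_fps prod.distrib[symmetric] prod.neutral_const)
qed

lemma complete_sym_0: "complete_sym 0 n (x :: nat \<Rightarrow> 'a::comm_ring_1) = 1"
  by (simp add: complete_sym_def)

section \<open>Monomial symmetric functions from products of power series\<close>

lemma prod_mset_filter_nonzero:
  fixes g :: "nat \<Rightarrow> 'a::comm_monoid_mult"
  assumes "g 0 = 1"
  shows "(\<Prod>p\<in>#{#p \<in># N. p \<noteq> 0#}. g p) = (\<Prod>p\<in>#N. g p)"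
  by (induction N) (auto simp: assms)

lemma sum_mset_filter_nonzero: "sum_mset {#p \<in># N. p \<noteq> (0::nat)#} = sum_mset N"
  by (induction N) auto

text \<open>An exponent vector is the multiplicity function of a multiset over {1..s}, the form in
  which \<open>fps_prod_nth'\<close> indexes coefficients. The hypothesis \<open>cong\<close> is
  there because outside {1..s} the multiplicities are 0, while extensional vectors are
  \<open>undefined\<close>.\<close>

lemma sum_monomial_exponents:
  fixes f :: "(nat \<Rightarrow> nat) \<Rightarrow> 'a::comm_monoid_add"
  assumes "\<mu> \<in> partitions_at_most k s"
    and cong: "\<And>a b. (\<And>i. i \<in> {1..s} \<Longrightarrow> a i = b i) \<Longrightarrow> f a = f b"
  shows "(\<Sum>a\<in>monomial_exponents \<mu> s. f a)
       = (\<Sum>M | M \<in> multisets_of_size {1..s} k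
             \<and> {#p \<in># image_mset (count M) (mset_set {1..s}). p \<noteq> 0#} = \<mu>. f (count M))"
proof -
  define dec where "dec a = (\<Sum>i=1..s. replicate_mset (a i) i)" for a :: "nat \<Rightarrow> nat"
  have count_dec: "count (dec a) i = (if i \<in> {1..s} then a i else 0)" for a i
    by (simp add: dec_def count_sum)
  have img: "image_mset (restrict (count M) {1..s}) (mset_set {1..s})
      = image_mset (count M) (mset_set {1..s})" for M
    by (rule image_mset_cong) auto
  have img': "image_mset (count (dec a)) (mset_set {1..s}) = image_mset a (mset_set {1..s})" for a
    by (rule image_mset_cong) (auto simp: count_dec)
  show ?thesis
  proof (rule sum.reindex_bij_witness[where i = "\<lambda>M. restrict (count M) {1..s}" and j = dec])
    fix a assume a: "a \<in> monomial_exponents \<mu> s"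
    then have a_ext: "a \<in> {1..s} \<rightarrow>\<^sub>E UNIV"
      and shape: "{#p \<in># image_mset a (mset_set {1..s}). p \<noteq> 0#} = \<mu>"
      by (auto simp: monomial_exponents_def)
    show "restrict (count (dec a)) {1..s} = a"
      using a_ext by (auto simp: restrict_def count_dec PiE_def extensional_def fun_eq_iff)
    have "size (dec a) = (\<Sum>i=1..s. a i)"
      by (simp add: dec_def)
    also have "\<dots> = sum_mset (image_mset a (mset_set {1..s}))"
      by (simp add: sum_unfold_sum_mset)
    also have "\<dots> = sum_mset \<mu>"
      using shape sum_mset_filter_nonzero by metis
    also have "\<dots> = k"
      using assms by (simp add: partitions_at_most_def)
    finally have size: "size (dec a) = k" .
    have "i \<in> {1..s}" if "i \<in># dec a" for i
      using that count_dec[of a i] by (auto simp flip: count_greater_zero_iff split: if_splits)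
    then show "dec a \<in> {M. M \<in> multisets_of_size {1..s} k
        \<and> {#p \<in># image_mset (count M) (mset_set {1..s}). p \<noteq> 0#} = \<mu>}"
      using size shape by (simp only: img' mem_Collect_eq) (auto simp: multisets_of_size_def)
    show "f (count (dec a)) = f a"
      by (rule cong) (simp add: count_dec)
  next
    fix M assume M: "M \<in> {M. M \<in> multisets_of_size {1..s} k
        \<and> {#p \<in># image_mset (count M) (mset_set {1..s}). p \<noteq> 0#} = \<mu>}"
    then show "dec (restrict (count M) {1..s}) = M"
      by (auto simp: multiset_eq_iff count_dec multisets_of_size_def not_in_iff[symmetric])
    show "restrict (count M) {1..s} \<in> monomial_exponents \<mu> s"
      using M unfolding monomial_exponents_def mem_Collect_eq img by simp
  qed
qed

text \<open>The terms of the expanded product are grouped by their multiset of nonzero exponents. As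
  \<open>g 0 = 1\<close>, the factor from \<open>g\<close> depends only on that partition, and the
  powers of \<open>w\<close> in one group add up to the monomial symmetric function. The s factors
  supply at most s parts.\<close>

lemma nth_prod_fps_eq_sum_partitions:
  fixes g w :: "nat \<Rightarrow> 'a::comm_ring_1"
  assumes "g 0 = 1"
  shows "fps_nth (\<Prod>j=1..s. Abs_fps (\<lambda>p. g p * w j ^ p)) k
       = (\<Sum>\<mu>\<in>partitions_at_most k s. monomial_sym \<mu> s w * (\<Prod>p\<in>#\<mu>. g p))"
proof -
  define shape where
    "shape a = {#p \<in># image_mset a (mset_set {1..s}). p \<noteq> 0#}" for a :: "nat \<Rightarrow> nat"
  have shape_in: "shape (count M) \<in> partitions_at_most k s" if "M \<in> multisets_of_size {1..s} k" for M
  proof -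
    have "sum_mset (shape (count M)) = (\<Sum>i=1..s. count M i)"
      unfolding shape_def sum_mset_filter_nonzero by (simp add: sum_unfold_sum_mset)
    also have "\<dots> = (\<Sum>i\<in>set_mset M. count M i)"
      using that by (intro sum.mono_neutral_right) (auto simp: multisets_of_size_def not_in_iff)
    also have "\<dots> = k"
      using that by (simp add: multisets_of_size_def size_multiset_overloaded_eq)
    finally have "sum_mset (shape (count M)) = k" .
    moreover have "size (shape (count M)) \<le> s"
      using size_filter_mset_lesseq[of "\<lambda>p. p \<noteq> 0" "image_mset (count M) (mset_set {1..s})"]
      by (simp add: shape_def)
    ultimately show ?thesis
      by (simp add: partitions_at_most_def shape_def)
  qed
  have prod_g: "(\<Prod>j=1..s. g (a j)) = (\<Prod>p\<in>#shape a. g p)" for a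
    unfolding shape_def prod_mset_filter_nonzero[of g, OF assms]
    by (simp add: prod_unfold_prod_mset image_mset.compositionality o_def)
  have "fps_nth (\<Prod>j=1..s. Abs_fps (\<lambda>p. g p * w j ^ p)) k
      = (\<Sum>M\<in>multisets_of_size {1..s} k. \<Prod>j=1..s. g (count M j) * w j ^ count M j)"
    by (simp add: fps_prod_nth')
  also have "\<dots> = (\<Sum>\<mu>\<in>partitions_at_most k s. \<Sum>M | M \<in> multisets_of_size {1..s} k
      \<and> shape (count M) = \<mu>. \<Prod>j=1..s. g (count M j) * w j ^ count M j)"
    using shape_in
    by (intro sum.group[symmetric] finite_partitions_at_most finite_multisets_of_size) auto
  also have "\<dots> = (\<Sum>\<mu>\<in>partitions_at_most k s. monomial_sym \<mu> s w * (\<Prod>p\<in>#\<mu>. g p))"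
  proof (rule sum.cong[OF refl])
    fix \<mu> assume \<mu>: "\<mu> \<in> partitions_at_most k s"
    have exponents: "shape a = \<mu>" if "a \<in> monomial_exponents \<mu> s" for a
      using that by (simp only: shape_def monomial_exponents_def mem_Collect_eq)
    have "(\<Sum>M | M \<in> multisets_of_size {1..s} k \<and> shape (count M) = \<mu>.
            \<Prod>j=1..s. g (count M j) * w j ^ count M j)
        = (\<Sum>a\<in>monomial_exponents \<mu> s. \<Prod>j=1..s. g (a j) * w j ^ a j)"
      unfolding shape_def by (rule sum_monomial_exponents[OF \<mu>, symmetric]) simp
    also have "\<dots> = monomial_sym \<mu> s w * (\<Prod>p\<in>#\<mu>. g p)"
      unfolding monomial_sym_def sum_distrib_right
      by (intro sum.cong) (simp_all add: prod.distrib prod_g exponents mult.commute del: One_nat_def)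
    finally show "(\<Sum>M | M \<in> multisets_of_size {1..s} k \<and> shape (count M) = \<mu>.
            \<Prod>j=1..s. g (count M j) * w j ^ count M j)
        = monomial_sym \<mu> s w * (\<Prod>p\<in>#\<mu>. g p)" .
  qed
  finally show ?thesis .
qed

text \<open>The sign moves from \<open>w\<close> to \<open>g\<close>: replacing \<open>g p\<close>
  by \<open>(-1) ^ p * g p\<close> keeps the value 1 at 0, and over the parts of a partition of k
  the signs multiply to \<open>(-1) ^ k\<close>.\<close>

lemma nth_prod_fps_uminus:
  fixes g w :: "nat \<Rightarrow> 'a::comm_ring_1"
  assumes "g 0 = 1"
  shows "fps_nth (\<Prod>j=1..s. Abs_fps (\<lambda>p. g p * (- w j) ^ p)) k
       = (-1) ^ k * (\<Sum>\<mu>\<in>partitions_at_most k s. monomial_sym \<mu> s w * (\<Prod>p\<in>#\<mu>. g p))"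
proof -
  have sgn: "(\<Prod>p\<in>#\<mu>. (-1) ^ p * g p) = (-1) ^ sum_mset \<mu> * (\<Prod>p\<in>#\<mu>. g p)" for \<mu>
    by (induction \<mu>) (simp_all add: power_add mult_ac)
  have "(\<Prod>j=1..s. Abs_fps (\<lambda>p. g p * (- w j) ^ p))
      = (\<Prod>j=1..s. Abs_fps (\<lambda>p. ((-1) ^ p * g p) * w j ^ p))"
    by (subst power_minus) (simp add: mult_ac)
  then have "fps_nth (\<Prod>j=1..s. Abs_fps (\<lambda>p. g p * (- w j) ^ p)) k
      = (\<Sum>\<mu>\<in>partitions_at_most k s. monomial_sym \<mu> s w * (\<Prod>p\<in>#\<mu>. (-1) ^ p * g p))"
    by (simp only: nth_prod_fps_eq_sum_partitions assms power_0 mult_1)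
  also have "\<dots> = (-1) ^ k
      * (\<Sum>\<mu>\<in>partitions_at_most k s. monomial_sym \<mu> s w * (\<Prod>p\<in>#\<mu>. g p))"
    unfolding sum_distrib_left sgn
    by (intro sum.cong) (auto simp: partitions_at_most_def mult.left_commute)
  finally show ?thesis .
qed

section \<open>The two identities over a commutative ring\<close>

text \<open>The hypothesis is the factorization of 1 + z + ... + z^s into the factors 1 - w_j z,
  stated by coefficients. It makes sense in every commutative ring, so the identities can be proved
  before roots of unity enter.\<close>

lemma geometric_sum_eq_prod:
  fixes w :: "nat \<Rightarrow> 'a::comm_ring_1"
  assumes "\<And>p. p \<le> s \<Longrightarrow> elementary_sym p s (\<lambda>j. - w j) = 1"
  shows "(\<Sum>j=0..s. (fps_const c * fps_X) ^ j) = (\<Prod>j=1..s. 1 + fps_const (- w j * c) * fps_X)"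
proof -
  have "(\<Prod>j=1..s. 1 + fps_const (- w j * c) * fps_X)
      = Abs_fps (\<lambda>p. elementary_sym p s (\<lambda>j. - w j) * c ^ p)"
    using prod_one_plus_fps_X_scaled[where x = "\<lambda>j. - w j"] by (simp add: mult.commute)
  also have "\<dots> = (\<Sum>j=0..s. (fps_const c * fps_X) ^ j)"
  proof (rule fps_ext)
    fix p
    show "fps_nth (Abs_fps (\<lambda>p. elementary_sym p s (\<lambda>j. - w j) * c ^ p)) p
        = fps_nth (\<Sum>j=0..s. (fps_const c * fps_X) ^ j) p"
      \<comment> \<open>Beyond degree s both sides vanish, the left one since s arguments have no
        products of more than s distinct factors.\<close>
      by (cases "p \<le> s")
         (simp_all add: assms elementary_sym_eq_0 fps_sum_nth power_mult_distrib
           fps_const_power fps_X_power_nth if_distrib cong: if_cong)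
  qed
  finally show ?thesis by simp
qed

theorem E_eq_sum_partitions:
  fixes w x :: "nat \<Rightarrow> 'a::comm_ring_1"
  assumes "\<And>p. p \<le> s \<Longrightarrow> elementary_sym p s (\<lambda>j. - w j) = 1"
  shows "E s k n x
       = (-1) ^ k * (\<Sum>\<mu>\<in>partitions_at_most k s. monomial_sym \<mu> s w * elementary_sym_part \<mu> n x)"
proof -
  have "gen_E s n x = (\<Prod>i=1..n. \<Prod>j=1..s. 1 + fps_const (- w j * x i) * fps_X)"
    by (simp only: gen_E_def geometric_sum_eq_prod[of s w, OF assms])
  also have "\<dots> = (\<Prod>j=1..s. \<Prod>i=1..n. 1 + fps_const (- w j * x i) * fps_X)"
    by (rule prod.swap)
  also have "\<dots> = (\<Prod>j=1..s. Abs_fps (\<lambda>p. elementary_sym p n x * (- w j) ^ p))"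
    by (simp only: prod_one_plus_fps_X_scaled)
  finally show ?thesis
    by (simp only: E_def elementary_sym_part_def nth_prod_fps_uminus elementary_sym_0)
qed

theorem H_eq_sum_partitions:
  fixes w x :: "nat \<Rightarrow> 'a::comm_ring_1"
  assumes "\<And>p. p \<le> s \<Longrightarrow> elementary_sym p s (\<lambda>j. - w j) = 1"
  shows "H s k n x
       = (-1) ^ k * (\<Sum>\<mu>\<in>partitions_at_most k s. monomial_sym \<mu> s w * complete_sym_part \<mu> n x)"
proof -
  let ?D = "\<Prod>i=1..n. \<Sum>j=0..s. (- (fps_const (x i) * fps_X)) ^ j"
  let ?G = "\<Prod>j=1..s. Abs_fps (\<lambda>p. complete_sym p n x * (- w j) ^ p)"
  \<comment> \<open>The double minus is kept so that the factors match those of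
    \<open>complete_sym_fps\<close> with \<open>c = - w j\<close>.\<close>
  have "(\<Sum>j=0..s. (- (fps_const (x i) * fps_X)) ^ j)
      = (\<Prod>j=1..s. 1 + fps_const (- (- w j * x i)) * fps_X)" for i
    using geometric_sum_eq_prod[of s w "- x i", OF assms]
    by (simp flip: fps_const_neg)
  then have "?D = (\<Prod>j=1..s. \<Prod>i=1..n. 1 + fps_const (- (- w j * x i)) * fps_X)"
    by (simp only: prod.swap[of _ "{1..s}"])
  then have "?G * ?D = 1"
    by (simp only: prod.distrib[symmetric] complete_sym_fps prod.neutral_const)
  \<comment> \<open>Both \<open>gen_H s n x\<close> and \<open>?G\<close> are inverse to
    \<open>?D\<close>, hence equal; no division of series is involved.\<close>
  then have "gen_H s n x = gen_H s n x * (?G * ?D)"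
    by (simp only: mult_1_right)
  also have "\<dots> = ?G * (gen_H s n x * ?D)"
    by (rule mult.left_commute)
  also have "\<dots> = ?G"
    by (simp only: gen_H_mult_eq_1 mult_1_right)
  finally have "gen_H s n x = ?G" .
  then show ?thesis
    by (simp only: H_def complete_sym_part_def nth_prod_fps_uminus complete_sym_0)
qed

section \<open>Roots of unity\<close>

lemma omega_eq_cis: "omega j m = cis (2 * pi * real j / real m)"
  by (simp add: omega_def cis_conv_exp mult_ac)

lemma omega_power:
  assumes "m > 0"
  shows "omega j m ^ m = 1"
  using bij_betw_roots_unity[OF assms] assms
  by (simp add: omega_eq_cis DeMoivre)

text \<open>The range includes j = 0, where the root is 1 for positive m, so injectivity also shows
  that the other roots in the range differ from 1.\<close>

lemma inj_on_omega: "inj_on (\<lambda>j. omega j m) {..<m}"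
  using bij_betw_roots_unity[of m] by (cases "m = 0") (auto simp: omega_eq_cis bij_betw_def)

text \<open>The values are the coefficients of the product \<open>P\<close> of the factors 1 -
  \<omega>_j z. It equals 1 + z + ... + z^s because both polynomials have degree at most s and agree
  at s + 1 points.\<close>

lemma elementary_sym_omega:
  assumes "p \<le> s"
  shows "elementary_sym p s (\<lambda>j. - omega j (s + 1)) = 1"
proof -
  let ?w = "\<lambda>j. omega j (s + 1)"
  define P where "P = (\<Prod>j=1..s. [:1, - ?w j:])"
  define Q :: "complex poly" where "Q = (\<Sum>j=0..s. monom 1 j)"
  have nz: "?w j \<noteq> 0" for j
    by (simp add: omega_def)
  have inj: "inj_on ?w {1..s}"
    by (rule inj_on_subset[OF inj_on_omega]) auto
  have "P = Q"
  proof (rule poly_eqI_degree)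
    \<comment> \<open>Common zeros at the s inverse roots fix the polynomials only up to a scalar;
      the point 0, where both are 1, settles it.\<close>
    let ?A = "insert 0 ((\<lambda>j. inverse (?w j)) ` {1..s})"
    have "inj_on (\<lambda>j. inverse (?w j)) {1..s}"
      by (rule inj_onI) (use inj_onD[OF inj] in simp)
    then have card: "card ?A = Suc s"
      using nz by (subst card_insert_disjoint) (auto simp: card_image)
    have "degree P \<le> sum (degree \<circ> (\<lambda>j. [:1, - ?w j:])) {1..s}"
      unfolding P_def by (rule degree_prod_sum_le) simp
    also have "\<dots> \<le> s"
      using sum_bounded_above[of "{1..s}" "degree \<circ> (\<lambda>j. [:1, - ?w j:])" 1] by simp
    finally show "card ?A > degree P"
      using card by simp
    have "degree Q \<le> s"
      unfolding Q_def by (intro degree_sum_le) (auto intro: order.trans[OF degree_monom_le])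
    then show "card ?A > degree Q"
      using card by simp
    fix z assume "z \<in> ?A"
    then consider "z = 0" | j where "j \<in> {1..s}" "z = inverse (?w j)"
      by auto
    then show "poly P z = poly Q z"
    proof cases
      case 1
      then show ?thesis
        by (simp add: P_def Q_def poly_prod poly_sum poly_monom power_0_left)
    next
      case 2
      have "?w j \<noteq> ?w 0"
        using inj_onD[OF inj_on_omega[of "s + 1"], of j 0] 2 by auto
      then have "z \<noteq> 1"
        using 2 nz by (auto simp: omega_def)
      moreover have "z ^ Suc s = 1"
        using omega_power[of "s + 1" j] by (simp add: 2 power_inverse del: power_Suc)
      ultimately have "poly Q z = 0"
        using geometric_sum[of z "Suc s"]
        by (simp add: Q_def poly_sum poly_monom atLeast0AtMost lessThan_Suc_atMost del: power_Suc)
      moreover have "poly P z = 0"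
        using 2 nz[of j] by (auto simp: P_def poly_prod intro!: bexI[of _ j])
      ultimately show ?thesis
        by simp
    qed
  qed
  \<comment> \<open>As a power series, \<open>P\<close> has its coefficients given by
    \<open>prod_one_plus_fps_X\<close>.\<close>
  moreover have "fps_of_poly P = (\<Prod>j=1..s. 1 + fps_const (- ?w j) * fps_X)"
    by (simp add: P_def fps_of_poly_prod fps_of_poly_pCons mult.commute)
  ultimately have "fps_of_poly Q = Abs_fps (\<lambda>p. elementary_sym p s (\<lambda>j. - ?w j))"
    by (simp only: prod_one_plus_fps_X)
  then have "elementary_sym p s (\<lambda>j. - ?w j) = coeff Q p"
    by (simp add: fps_eq_iff)
  also have "\<dots> = 1"
    using assms by (simp add: Q_def coeff_sum)
  finally show ?thesis .
qed

section \<open>Transfer from the complex numbers to the polynomial ring\<close>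

lemma Const_0: "Const 0 = 0"
  and Const_1: "Const 1 = 1"
  and Const_add: "Const (a + b) = Const a + Const b"
  and Const_uminus: "Const (- a) = - Const a"
  and Const_mult: "Const (a * b) = Const a * Const b"
  by (simp_all add: Const_def single_add single_uminus mult_single)

lemma Const_sum: "Const (sum f A) = (\<Sum>a\<in>A. Const (f a))"
  by (induction A rule: infinite_finite_induct) (simp_all add: Const_0 Const_add)

lemma Const_prod: "Const (prod f A) = (\<Prod>a\<in>A. Const (f a))"
  by (induction A rule: infinite_finite_induct) (simp_all add: Const_1 Const_mult)

lemma Const_power: "Const (a ^ k) = Const a ^ k"
  by (induction k) (simp_all add: Const_1 Const_mult)

lemma Const_elementary_sym: "Const (elementary_sym k n x) = elementary_sym k n (\<lambda>i. Const (x i))"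
  by (simp add: elementary_sym_def Const_sum Const_prod)

lemma Const_monomial_sym: "Const (monomial_sym \<mu> n x) = monomial_sym \<mu> n (\<lambda>i. Const (x i))"
  by (simp add: monomial_sym_def Const_sum Const_prod Const_power)

theorem theorem3p1:
  fixes k s n :: nat
  assumes "k \<ge> 1" and "s \<ge> 1" and "n \<ge> 1"
  shows "H s k n Var =
           (-1) ^ k * (\<Sum>\<mu>\<in>partitions_at_most k s.
              Const (monomial_sym \<mu> s (\<lambda>j. omega j (s + 1))) * complete_sym_part \<mu> n Var)
       \<and> E s k n Var =
           (-1) ^ k * (\<Sum>\<mu>\<in>partitions_at_most k s.
              Const (monomial_sym \<mu> s (\<lambda>j. omega j (s + 1))) * elementary_sym_part \<mu> n Var)"
proof -
  \<comment> \<open>The general identities need \<open>w\<close> and \<open>x\<close> in one ring,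
    so the roots of unity are taken as constant polynomials; the ring homomorphism
    \<open>Const\<close> carries their relation over.\<close>
  have "elementary_sym p s (\<lambda>j. - Const (omega j (s + 1))) = 1" if "p \<le> s" for p
    using arg_cong[OF elementary_sym_omega[OF that], of Const]
    by (simp add: Const_elementary_sym Const_uminus Const_1)
  then show ?thesis
    unfolding Const_monomial_sym by (intro conjI H_eq_sum_partitions E_eq_sum_partitions)
qed

end
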